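(* Let $\Omega_i\subseteq\mathbb{C}$, $1\le i\le d$, be simply connected domains, let $\Omega=\prod_{i=1}^d\Omega_i$, and let $f:\Omega\to\mathbb{C}$ be holomorphic. Then the set $B(f)$ of balanced points of $f$ is a $G_\delta$ subset of $\mathbb{C}^d$.
   Context: A point $z\in\partial\Omega$ is called balanced (for $f$) if, for all differential operators $D=\partial^{a_1+\dots+a_d}/\partial z_1^{a_1}\cdots\partial z_d^{a_d}$ ($a\in\mathbb{N}^d$) of mixed partial derivatives, $Df$ can be continuously extended to the point $z$. $B(f)$ denotes the set of all balanced points. *)

theory Defs
  imports "HOL-Analysis.Analysis"
begin

definition product_domain :: "('d::finite \<Rightarrow> complex set) \<Rightarrow> (complex ^ 'd) set" where
  "product_domain \<Omega> = {z. \<forall>i. z $ i \<in> \<Omega> i}"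

text \<open>
  Holomorphy in several variables: Frechet differentiability over the reals with a
  derivative that is complex-linear. Real-linearity is part of \<^const>\<open>has_derivative\<close>,
  so only homogeneity for complex scalars has to be added. The definition is meant
  for open sets.
\<close>

definition holomorphic_several_on ::
    "(complex ^ 'd::finite \<Rightarrow> complex) \<Rightarrow> (complex ^ 'd) set \<Rightarrow> bool" where
  "holomorphic_several_on f S \<longleftrightarrow>
     (\<forall>z\<in>S. \<exists>f'. (f has_derivative f') (at z within S) \<and> (\<forall>c v. f' (c *s v) = c * f' v))"

definition partial_deriv ::
    "'d::finite \<Rightarrow> (complex ^ 'd \<Rightarrow> complex) \<Rightarrow> complex ^ 'd \<Rightarrow> complex" where
  "partial_deriv j f z = deriv (\<lambda>w. f (\<chi> i. if i = j then w else z $ i)) (z $ j)"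

text \<open>
  The linear order on the index type only fixes the order of composition:
  the derivatives in the largest index are taken first.
\<close>

definition mixed_partial ::
    "('d \<Rightarrow> nat) \<Rightarrow> (complex ^ ('d::{finite,linorder}) \<Rightarrow> complex) \<Rightarrow>
       complex ^ ('d::{finite,linorder}) \<Rightarrow> complex" where
  "mixed_partial a f = foldr (\<lambda>j. partial_deriv j ^^ a j) (sorted_list_of_set UNIV) f"

definition extends_continuously_to ::
    "('a::topological_space \<Rightarrow> 'b::topological_space) \<Rightarrow> 'a set \<Rightarrow> 'a \<Rightarrow> bool" where
  "extends_continuously_to h S z \<longleftrightarrow>
     (\<exists>g. continuous_on (insert z S) g \<and> (\<forall>w\<in>S. g w = h w))"

definition balanced_points ::
    "(complex ^ ('d::{finite,linorder})) set \<Rightarrow> (complex ^ ('d::{finite,linorder}) \<Rightarrow> complex) \<Rightarrow>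
       (complex ^ ('d::{finite,linorder})) set" where
  "balanced_points S f =
     {z \<in> frontier S. \<forall>a. extends_continuously_to (mixed_partial a f) S z}"

end

theory Submission
  imports Defs
begin

text \<open>
  A function that is continuous on an open set \<open>S\<close> extends continuously to a boundary point
  exactly when it has a limit there along \<open>S\<close>, and the points at which a map into a complete
  space has a limit form a \<open>G\<^sub>\<delta>\<close> set. Balancedness is such a condition for each of the
  countably many mixed partial derivatives.
\<close>

lemma extends_continuously_to_imp_tendsto:
  assumes "extends_continuously_to h S z" and "z \<notin> S"
  shows "\<exists>l. (h \<longlongrightarrow> l) (at z within S)"
proof -
  obtain g where g: "continuous_on (insert z S) g" and gh: "\<And>w. w \<in> S \<Longrightarrow> g w = h w"
    using assms(1) unfolding extends_continuously_to_def by blast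
  have "(g \<longlongrightarrow> g z) (at z within S)"
    using g by (metis continuous_on_def insertI1 subset_insertI tendsto_within_subset)
  then have "(h \<longlongrightarrow> g z) (at z within S)"
    by (rule Lim_transform_eventually) (auto simp: eventually_at_filter gh)
  then show ?thesis ..
qed

text \<open>The extension is \<open>h(z := l)\<close>. The limit gives continuity at
  \<open>z\<close>; elsewhere openness of \<open>S\<close> lets a small neighbourhood avoid
  \<open>z\<close>, so continuity of \<open>h\<close> carries over.\<close>

lemma tendsto_imp_extends_continuously_to:
  fixes h :: "'a::t1_space \<Rightarrow> 'b::topological_space"
  assumes S: "open S" and h: "continuous_on S h" and z: "z \<notin> S"
    and lim: "(h \<longlongrightarrow> l) (at z within S)"
  shows "extends_continuously_to h S z"
proof -
  have "continuous_on (insert z S) (h(z := l))"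
    unfolding continuous_on_def
  proof
    fix u assume u: "u \<in> insert z S"
    show "((h(z := l)) \<longlongrightarrow> (h(z := l)) u) (at u within insert z S)"
    proof (cases "u = z")
      case True
      have "((h(z := l)) \<longlongrightarrow> l) (at z within S)"
        using lim by (rule Lim_transform_eventually) (auto simp: eventually_at_filter)
      \<comment> \<open>The punctured filter ignores the point \<open>z\<close> itself, so adjoining
        \<open>z\<close> to the set changes nothing.\<close>
      moreover have "at z within insert z S = at z within S"
        by (simp add: at_within_def insert_Diff_if)
      ultimately show ?thesis using True by simp
    next
      case False
      then have "u \<in> S" using u by blast
      have "at u within insert z S = at u within S"
        using \<open>u \<in> S\<close> S by (metis at_within_open at_within_open_subset subset_insertI)
      moreover have "((h(z := l)) \<longlongrightarrow> h u) (at u within S)"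
        using h[unfolded continuous_on_def, rule_format, OF \<open>u \<in> S\<close>]
        by (rule Lim_transform_eventually) (use z in \<open>auto simp: eventually_at_filter\<close>)
      ultimately show ?thesis using False by simp
    qed
  qed
  then show ?thesis
    unfolding extends_continuously_to_def using z by (intro exI[of _ "h(z := l)"]) auto
qed

text \<open>By completeness, a limit at \<open>z\<close> exists once \<open>h\<close> has
  arbitrarily small oscillation on \<open>S\<close> near \<open>z\<close>, with \<open>z\<close>
  itself removed. Oscillation below 1/n is an open condition on \<open>z\<close>: near another point
  of such a neighbourhood, the T1 property allows \<open>z\<close> to be cut out. Points that are
  not limit points of \<open>S\<close> qualify trivially.\<close>

lemma gdelta_in_points_of_limit_within:
  fixes h :: "'a::t1_space \<Rightarrow> 'b::complete_space"
  shows "gdelta_in euclidean {z. \<exists>l. (h \<longlongrightarrow> l) (at z within S)}"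
proof -
  \<comment> \<open>This translates the filter of abstract topologies, used by
    \<open>gdelta_in_points_of_convergence_within\<close>, into the type-class one.\<close>
  have "atin_within euclidean z S = at z within S" for z :: 'a
    by (simp add: filter_eq_iff eventually_atin_within eventually_at_topological) blast
  moreover have "t1_space (euclidean :: 'a topology)"
    unfolding t1_space_def using t1_space by auto
  ultimately show ?thesis
    using gdelta_in_points_of_convergence_within[OF completely_metrizable_space_euclidean,
        of "euclidean :: 'a topology" S h] by simp
qed

text \<open>Splitting on continuity of \<open>h\<close> on \<open>S\<close> covers arbitrary
  \<open>h\<close>, so the result applies directly to every mixed partial derivative.\<close>

lemma gdelta_in_extension_points:
  fixes h :: "'a::metric_space \<Rightarrow> 'b::complete_space"
  assumes "open S"
  shows "gdelta_in euclidean {z \<in> frontier S. extends_continuously_to h S z}"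
proof (cases "continuous_on S h")
  case True
  have "z \<notin> S" if "z \<in> frontier S" for z
    using that assms by (simp add: frontier_def interior_open)
  then have "{z \<in> frontier S. extends_continuously_to h S z} =
      frontier S \<inter> {z. \<exists>l. (h \<longlongrightarrow> l) (at z within S)}"
    using extends_continuously_to_imp_tendsto
      tendsto_imp_extends_continuously_to[OF assms True] by blast
  \<comment> \<open>The frontier is closed, and closed sets in a metrizable space are
    G-delta.\<close>
  moreover have "gdelta_in euclidean (frontier S)"
    by (intro closed_imp_gdelta_in metrizable_space_euclidean) simp
  ultimately show ?thesis
    by (simp add: gdelta_in_Int gdelta_in_points_of_limit_within)
next
  case False
  \<comment> \<open>An extension agrees with \<open>h\<close> on \<open>S\<close>, so its
    restriction would make \<open>h\<close> continuous there. The set in question is therefore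
    empty.\<close>
  have "\<not> extends_continuously_to h S z" for z
    using False unfolding extends_continuously_to_def
    by (metis continuous_on_cong continuous_on_subset subset_insertI)
  then show ?thesis by simp
qed

lemma open_product_domain:
  assumes "\<And>i. open (\<Omega> i)"
  shows "open (product_domain \<Omega>)"
  unfolding product_domain_def using assms by (intro open_vector_box) auto

theorem theorem4p4:
  fixes \<Omega> :: "'d::{finite,linorder} \<Rightarrow> complex set"
    and f :: "complex ^ ('d::{finite,linorder}) \<Rightarrow> complex"
  assumes "\<And>i. open (\<Omega> i)"
    and "\<And>i. connected (\<Omega> i)"
    and "\<And>i. \<Omega> i \<noteq> {}"
    and "\<And>i. simply_connected (\<Omega> i)"
    and "holomorphic_several_on f (product_domain \<Omega>)"
  shows "gdelta_in euclidean (balanced_points (product_domain \<Omega>) f)"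
proof -
  let ?S = "product_domain \<Omega>"
  have "balanced_points ?S f =
      (\<Inter>a. {z \<in> frontier ?S. extends_continuously_to (mixed_partial a f) ?S z})"
    unfolding balanced_points_def by auto
  \<comment> \<open>Since \<open>'d\<close> is finite, the type \<open>'d \<Rightarrow> nat\<close>
    of multi-indices is countable, and so is the intersection.\<close>
  moreover have "gdelta_in euclidean \<dots>"
    using gdelta_in_extension_points[OF open_product_domain[OF assms(1)]]
    by (intro gdelta_in_Inter) auto
  ultimately show ?thesis by simp
qed

end
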